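(* A fibered preorder $\mathcal{A}:|\mathcal{A}|\to\mathbf{Set}$ can up to equivalence be represented by a uniform preorder (i.e. $\mathcal{A}\simeq\mathrm{ufam}(I,A,R)$ for some uniform preorder $(I,A,R)$) if and only if it has a generic family $(\iota_i\in\mathcal{A}_{A_i})_{i\in I}$ of predicates and is a pre-stack with respect to the regular topology, which means that $e^*\varphi\le e^*\psi$ implies $\varphi\le\psi$ for surjective $e:J\to I$.
   Context: A fibered preorder on $\mathbf{Set}$ is a fibration $\mathcal{A}:|\mathcal{A}|\to\mathbf{Set}$ that is faithful as a functor; its fibers $\mathcal{A}_M$ are preorders, whose elements are called predicates on $M$; $u^*$ is reindexing along $u$. Equivalence is fibered equivalence over $\mathbf{Set}$. A family $(\iota_i\in\mathcal{A}_{A_i})_{i\in I}$ of predicates, indexed by a set $I$, is generic if for every set $M$ and every predicate $\varphi\in\mathcal{A}_M$ there are $i\in I$ and $f:M\to A_i$ with $\varphi\cong f^*\iota_i$. A uniform preorder is a triple $(I,A,R)$ with $I$ a set, $A=(A_i)_{i\in I}$ a family of sets and $R=(R_{ij})_{i,j\in I}$ a family with $R_{ij}\subseteq P(A_i\times A_j)$, such that (a) $r\in R_{ij}$, $s\subseteq r$ imply $s\in R_{ij}$; (b) $\mathrm{id}\in R_{ii}$; (c) $r\in R_{ij}$, $s\in R_{jk}$ imply $sr\in R_{ik}$, where $sr=\{(x,z)\mid\exists y:(x,y)\in r,(y,z)\in s\}$. $\mathrm{ufam}(I,A,R)$ is the fibered preorder on $\mathbf{Set}$ whose predicates on $M$ are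 pairs $(i\in I,\varphi:M\to A_i)$, with $(i,\varphi)\le(j,\psi)$ iff $\{(\varphi m,\psi m)\mid m\in M\}\in R_{ij}$, and with reindexing given by precomposition. *)

theory Defs
  imports Main "HOL-Library.FuncSet"
begin

section \<open>Categories and functors\<close>

record ('o, 'a) cat =
  obj :: "'o set"
  arr :: "'a set"
  src :: "'a \<Rightarrow> 'o"
  tgt :: "'a \<Rightarrow> 'o"
  ide :: "'o \<Rightarrow> 'a"
  cmp :: "'a \<Rightarrow> 'a \<Rightarrow> 'a"  \<comment> \<open>\<open>cmp C g f\<close> is \<open>g\<close> after \<open>f\<close>\<close>

definition hom :: "('o, 'a) cat \<Rightarrow> 'o \<Rightarrow> 'o \<Rightarrow> 'a set" where
  "hom C X Y = {f \<in> arr C. src C f = X \<and> tgt C f = Y}"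

locale category =
  fixes C :: "('o, 'a) cat"
  assumes src_obj: "f \<in> arr C \<Longrightarrow> src C f \<in> obj C"
    and tgt_obj: "f \<in> arr C \<Longrightarrow> tgt C f \<in> obj C"
    and ide_hom: "X \<in> obj C \<Longrightarrow> ide C X \<in> hom C X X"
    and cmp_hom: "f \<in> hom C X Y \<Longrightarrow> g \<in> hom C Y Z \<Longrightarrow> cmp C g f \<in> hom C X Z"
    and cmp_ide_right: "f \<in> hom C X Y \<Longrightarrow> cmp C f (ide C X) = f"
    and cmp_ide_left: "f \<in> hom C X Y \<Longrightarrow> cmp C (ide C Y) f = f"
    and cmp_assoc: "f \<in> hom C W X \<Longrightarrow> g \<in> hom C X Y \<Longrightarrow> h \<in> hom C Y Z \<Longrightarrow>
      cmp C h (cmp C g f) = cmp C (cmp C h g) f"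

definition iso_arr :: "('o, 'a) cat \<Rightarrow> 'a \<Rightarrow> bool" where
  "iso_arr C f \<longleftrightarrow> f \<in> arr C \<and>
    (\<exists>g \<in> hom C (tgt C f) (src C f).
      cmp C g f = ide C (src C f) \<and> cmp C f g = ide C (tgt C f))"

record ('o, 'a, 'p, 'b) fctr =
  onobj :: "'o \<Rightarrow> 'p"
  onarr :: "'a \<Rightarrow> 'b"

locale is_functor = source: category C + target: category D
  for C :: "('o, 'a) cat" and D :: "('p, 'b) cat" +
  fixes F :: "('o, 'a, 'p, 'b) fctr"
  assumes onobj_obj: "X \<in> obj C \<Longrightarrow> onobj F X \<in> obj D"
    and onarr_hom: "f \<in> hom C X Y \<Longrightarrow> onarr F f \<in> hom D (onobj F X) (onobj F Y)"
    and onarr_ide: "X \<in> obj C \<Longrightarrow> onarr F (ide C X) = ide D (onobj F X)"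
    and onarr_cmp: "f \<in> hom C X Y \<Longrightarrow> g \<in> hom C Y Z \<Longrightarrow>
      onarr F (cmp C g f) = cmp D (onarr F g) (onarr F f)"

definition id_fctr :: "('o, 'a, 'o, 'a) fctr" where
  "id_fctr = \<lparr>onobj = (\<lambda>X. X), onarr = (\<lambda>f. f)\<rparr>"

definition comp_fctr ::
  "('p, 'b, 'q, 'c) fctr \<Rightarrow> ('o, 'a, 'p, 'b) fctr \<Rightarrow> ('o, 'a, 'q, 'c) fctr" where
  "comp_fctr G F = \<lparr>onobj = onobj G \<circ> onobj F, onarr = onarr G \<circ> onarr F\<rparr>"

definition faithful :: "('o, 'a) cat \<Rightarrow> ('o, 'a, 'p, 'b) fctr \<Rightarrow> bool" where
  "faithful C F \<longleftrightarrow> (\<forall>X Y. inj_on (onarr F) (hom C X Y))"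


section \<open>Fibrations\<close>

definition cartesian ::
  "('p, 'b) cat \<Rightarrow> ('o, 'a) cat \<Rightarrow> ('o, 'a, 'p, 'b) fctr \<Rightarrow> 'a \<Rightarrow> bool" where
  "cartesian B E P f \<longleftrightarrow> f \<in> arr E \<and>
    (\<forall>Y \<in> obj E. \<forall>g \<in> hom E Y (tgt E f).
      \<forall>w \<in> hom B (onobj P Y) (onobj P (src E f)).
        cmp B (onarr P f) w = onarr P g \<longrightarrow>
        (\<exists>!h. h \<in> hom E Y (src E f) \<and> onarr P h = w \<and> cmp E f h = g))"

definition fibration ::
  "('p, 'b) cat \<Rightarrow> ('o, 'a) cat \<Rightarrow> ('o, 'a, 'p, 'b) fctr \<Rightarrow> bool" where
  "fibration B E P \<longleftrightarrow> is_functor E B P \<and>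
    (\<forall>X \<in> obj E. \<forall>J \<in> obj B. \<forall>u \<in> hom B J (onobj P X).
      \<exists>f \<in> arr E. tgt E f = X \<and> onarr P f = u \<and> cartesian B E P f)"

definition fiber :: "('o, 'a) cat \<Rightarrow> ('o, 'a, 'p, 'b) fctr \<Rightarrow> 'p \<Rightarrow> 'o set" where
  "fiber E P M = {X \<in> obj E. onobj P X = M}"

definition fiber_le ::
  "('p, 'b) cat \<Rightarrow> ('o, 'a) cat \<Rightarrow> ('o, 'a, 'p, 'b) fctr \<Rightarrow> 'p \<Rightarrow> 'o \<Rightarrow> 'o \<Rightarrow> bool" where
  "fiber_le B E P M X Y \<longleftrightarrow> X \<in> fiber E P M \<and> Y \<in> fiber E P M \<and>
    (\<exists>f \<in> hom E X Y. onarr P f = ide B M)"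

definition fiber_equiv ::
  "('p, 'b) cat \<Rightarrow> ('o, 'a) cat \<Rightarrow> ('o, 'a, 'p, 'b) fctr \<Rightarrow> 'p \<Rightarrow> 'o \<Rightarrow> 'o \<Rightarrow> bool" where
  "fiber_equiv B E P M X Y \<longleftrightarrow> fiber_le B E P M X Y \<and> fiber_le B E P M Y X"

text \<open>Reindexing along \<open>u\<close> is given by a chosen cartesian lift; in a fibration it is
  determined up to vertical isomorphism.\<close>

definition reindex ::
  "('p, 'b) cat \<Rightarrow> ('o, 'a) cat \<Rightarrow> ('o, 'a, 'p, 'b) fctr \<Rightarrow> 'b \<Rightarrow> 'o \<Rightarrow> 'o" where
  "reindex B E P u X =
    (SOME X'. \<exists>f \<in> hom E X' X. onarr P f = u \<and> cartesian B E P f)"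

definition fibered_functor ::
  "('p, 'b) cat \<Rightarrow> ('o, 'a) cat \<Rightarrow> ('o, 'a, 'p, 'b) fctr \<Rightarrow>
   ('q, 'c) cat \<Rightarrow> ('q, 'c, 'p, 'b) fctr \<Rightarrow> ('o, 'a, 'q, 'c) fctr \<Rightarrow> bool" where
  "fibered_functor B E P E' P' F \<longleftrightarrow> is_functor E E' F \<and>
    (\<forall>X \<in> obj E. onobj P' (onobj F X) = onobj P X) \<and>
    (\<forall>f \<in> arr E. onarr P' (onarr F f) = onarr P f) \<and>
    (\<forall>f. cartesian B E P f \<longrightarrow> cartesian B E' P' (onarr F f))"

definition vertical_nat_iso ::
  "('p, 'b) cat \<Rightarrow> ('q, 'c) cat \<Rightarrow> ('o, 'a) cat \<Rightarrow> ('o, 'a, 'p, 'b) fctr \<Rightarrow>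
   ('q, 'c, 'o, 'a) fctr \<Rightarrow> ('q, 'c, 'o, 'a) fctr \<Rightarrow> ('q \<Rightarrow> 'a) \<Rightarrow> bool" where
  "vertical_nat_iso B D E P F G \<eta> \<longleftrightarrow>
    (\<forall>X \<in> obj D. \<eta> X \<in> hom E (onobj F X) (onobj G X) \<and> iso_arr E (\<eta> X) \<and>
      onarr P (\<eta> X) = ide B (onobj P (onobj F X))) \<and>
    (\<forall>X Y. \<forall>f \<in> hom D X Y.
      cmp E (onarr G f) (\<eta> X) = cmp E (\<eta> Y) (onarr F f))"

definition fibered_equivalent ::
  "('p, 'b) cat \<Rightarrow> ('o, 'a) cat \<Rightarrow> ('o, 'a, 'p, 'b) fctr \<Rightarrow>
   ('q, 'c) cat \<Rightarrow> ('q, 'c, 'p, 'b) fctr \<Rightarrow> bool" where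
  "fibered_equivalent B E P E' P' \<longleftrightarrow>
    (\<exists>F G \<eta> \<epsilon>. fibered_functor B E P E' P' F \<and> fibered_functor B E' P' E P G \<and>
      vertical_nat_iso B E E P id_fctr (comp_fctr G F) \<eta> \<and>
      vertical_nat_iso B E' E' P' (comp_fctr F G) id_fctr \<epsilon>)"


section \<open>The category of sets\<close>

text \<open>The universe of sets is a parameter: a collection \<open>U\<close> of subsets of a type.  No powerset
  axiom is imposed.  Examples are all subsets of an infinite type, and, when the type carries
  a model of ZFC, the extensions of its elements, for which \<open>SET U\<close> is the usual category of
  sets and functions.\<close>

locale set_universe =
  fixes U :: "'u set set"
  assumes subset_closed: "X \<in> U \<Longrightarrow> Y \<subseteq> X \<Longrightarrow> Y \<in> U"
    and image_closed: "X \<in> U \<Longrightarrow> f ` X \<in> U"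
    and product_closed:
      "X \<in> U \<Longrightarrow> Y \<in> U \<Longrightarrow> \<exists>p. inj_on p (X \<times> Y) \<and> p ` (X \<times> Y) \<in> U"
    and infinity: "\<exists>X \<in> U. infinite X"

text \<open>An arrow carries its domain and codomain; its underlying function is \<open>undefined\<close> outside
  the domain, so that equality of arrows is equality of maps.\<close>

type_synonym 'u set_arr = "'u set \<times> ('u \<Rightarrow> 'u) \<times> 'u set"

definition SET :: "'u set set \<Rightarrow> ('u set, 'u set_arr) cat" where
  "SET U = \<lparr>
    obj = U,
    arr = {(M, f, N). M \<in> U \<and> N \<in> U \<and> f \<in> M \<rightarrow>\<^sub>E N},
    src = (\<lambda>(M, f, N). M),
    tgt = (\<lambda>(M, f, N). N),
    ide = (\<lambda>M. (M, restrict (\<lambda>x. x) M, M)),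
    cmp = (\<lambda>(M', g, N') (M, f, N). (M, compose M g f, N'))\<rparr>"


section \<open>Fibered preorders on the category of sets\<close>

definition fibered_preorder ::
  "'u set set \<Rightarrow> ('o, 'a) cat \<Rightarrow> ('o, 'a, 'u set, 'u set_arr) fctr \<Rightarrow> bool" where
  "fibered_preorder U E P \<longleftrightarrow> fibration (SET U) E P \<and> faithful E P"

definition generic_family ::
  "'u set set \<Rightarrow> ('o, 'a) cat \<Rightarrow> ('o, 'a, 'u set, 'u set_arr) fctr \<Rightarrow>
   'u set \<Rightarrow> ('u \<Rightarrow> 'u set) \<Rightarrow> ('u \<Rightarrow> 'o) \<Rightarrow> bool" where
  "generic_family U E P I A \<iota> \<longleftrightarrow> I \<in> U \<and>
    (\<forall>i \<in> I. A i \<in> U \<and> \<iota> i \<in> fiber E P (A i)) \<and>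
    (\<forall>M \<in> U. \<forall>\<phi> \<in> fiber E P M. \<exists>i \<in> I. \<exists>f \<in> M \<rightarrow>\<^sub>E A i.
      fiber_equiv (SET U) E P M \<phi> (reindex (SET U) E P (M, f, A i) (\<iota> i)))"

definition prestack ::
  "'u set set \<Rightarrow> ('o, 'a) cat \<Rightarrow> ('o, 'a, 'u set, 'u set_arr) fctr \<Rightarrow> bool" where
  "prestack U E P \<longleftrightarrow>
    (\<forall>J \<in> U. \<forall>I \<in> U. \<forall>e \<in> J \<rightarrow>\<^sub>E I. e ` J = I \<longrightarrow>
      (\<forall>\<phi> \<in> fiber E P I. \<forall>\<psi> \<in> fiber E P I.
        fiber_le (SET U) E P J
          (reindex (SET U) E P (J, e, I) \<phi>) (reindex (SET U) E P (J, e, I) \<psi>) \<longrightarrow>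
        fiber_le (SET U) E P I \<phi> \<psi>))"


section \<open>The total category of an indexed preorder\<close>

text \<open>Given predicates \<open>Pr M\<close> on \<open>M\<close>, an order \<open>le M\<close> on them, and reindexing \<open>rx M u\<close> along
  a map \<open>u\<close> with domain \<open>M\<close>, an arrow from \<open>(M, \<phi>)\<close> to \<open>(N, \<psi>)\<close> is a map \<open>u\<close> from
  \<open>M\<close> to \<open>N\<close> such that \<open>\<phi>\<close> is below the reindexing of \<open>\<psi>\<close> along \<open>u\<close>.\<close>

type_synonym ('u, 'p) tot_obj = "'u set \<times> 'p"
type_synonym ('u, 'p) tot_arr = "('u, 'p) tot_obj \<times> ('u \<Rightarrow> 'u) \<times> ('u, 'p) tot_obj"

definition total_cat ::
  "'u set set \<Rightarrow> ('u set \<Rightarrow> 'p set) \<Rightarrow> ('u set \<Rightarrow> 'p \<Rightarrow> 'p \<Rightarrow> bool) \<Rightarrow>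
   ('u set \<Rightarrow> ('u \<Rightarrow> 'u) \<Rightarrow> 'p \<Rightarrow> 'p) \<Rightarrow> (('u, 'p) tot_obj, ('u, 'p) tot_arr) cat" where
  "total_cat U Pr le rx = \<lparr>
    obj = {(M, \<phi>). M \<in> U \<and> \<phi> \<in> Pr M},
    arr = {((M, \<phi>), u, (N, \<psi>)). M \<in> U \<and> \<phi> \<in> Pr M \<and> N \<in> U \<and> \<psi> \<in> Pr N \<and>
            u \<in> M \<rightarrow>\<^sub>E N \<and> le M \<phi> (rx M u \<psi>)},
    src = (\<lambda>(X, u, Y). X),
    tgt = (\<lambda>(X, u, Y). Y),
    ide = (\<lambda>X. (X, restrict (\<lambda>x. x) (fst X), X)),
    cmp = (\<lambda>(Y', v, Z) (X, u, Y). (X, compose (fst X) v u, Z))\<rparr>"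

definition total_proj ::
  "(('u, 'p) tot_obj, ('u, 'p) tot_arr, 'u set, 'u set_arr) fctr" where
  "total_proj = \<lparr>onobj = fst, onarr = (\<lambda>(X, u, Y). (fst X, u, fst Y))\<rparr>"


section \<open>Uniform preorders\<close>

locale uniform_preorder =
  fixes U :: "'u set set" and I :: "'u set" and A :: "'u \<Rightarrow> 'u set"
    and R :: "'u \<Rightarrow> 'u \<Rightarrow> ('u \<times> 'u) set set"
  assumes index_set: "I \<in> U"
    and carrier_set: "i \<in> I \<Longrightarrow> A i \<in> U"
    and rel_subset: "i \<in> I \<Longrightarrow> j \<in> I \<Longrightarrow> R i j \<subseteq> Pow (A i \<times> A j)"
    and rel_down: "i \<in> I \<Longrightarrow> j \<in> I \<Longrightarrow> r \<in> R i j \<Longrightarrow> s \<subseteq> r \<Longrightarrow> s \<in> R i j"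
    and rel_id: "i \<in> I \<Longrightarrow> Id_on (A i) \<in> R i i"
    and rel_comp: "i \<in> I \<Longrightarrow> j \<in> I \<Longrightarrow> k \<in> I \<Longrightarrow> r \<in> R i j \<Longrightarrow> s \<in> R j k \<Longrightarrow> r O s \<in> R i k"

type_synonym 'u ufam_pred = "'u \<times> ('u \<Rightarrow> 'u)"

definition ufam_preds :: "'u set \<Rightarrow> ('u \<Rightarrow> 'u set) \<Rightarrow> 'u set \<Rightarrow> 'u ufam_pred set" where
  "ufam_preds I A M = {(i, \<phi>). i \<in> I \<and> \<phi> \<in> M \<rightarrow>\<^sub>E A i}"

definition ufam_le ::
  "('u \<Rightarrow> 'u \<Rightarrow> ('u \<times> 'u) set set) \<Rightarrow> 'u set \<Rightarrow> 'u ufam_pred \<Rightarrow> 'u ufam_pred \<Rightarrow> bool" where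
  "ufam_le R M = (\<lambda>(i, \<phi>) (j, \<psi>). {(\<phi> m, \<psi> m) | m. m \<in> M} \<in> R i j)"

definition ufam_reindex :: "'u set \<Rightarrow> ('u \<Rightarrow> 'u) \<Rightarrow> 'u ufam_pred \<Rightarrow> 'u ufam_pred" where
  "ufam_reindex M u = (\<lambda>(i, \<phi>). (i, compose M \<phi> u))"

definition ufam ::
  "'u set set \<Rightarrow> 'u set \<Rightarrow> ('u \<Rightarrow> 'u set) \<Rightarrow> ('u \<Rightarrow> 'u \<Rightarrow> ('u \<times> 'u) set set) \<Rightarrow>
   (('u, 'u ufam_pred) tot_obj, ('u, 'u ufam_pred) tot_arr) cat" where
  "ufam U I A R = total_cat U (ufam_preds I A) (ufam_le R) ufam_reindex"

end

theory Submission imports Defs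
begin

text \<open>
  In a faithful fibration everything is expressed by the relation ``some arrow from \<open>X\<close> to \<open>Y\<close>
  lies over \<open>u\<close>''; in particular a fibered equivalence is a pair of maps on objects that
  preserve this relation and are mutually inverse up to vertical isomorphism.

  Given an equivalence with \<open>ufam(I,A,R)\<close>, the predicates corresponding to \<open>(i, id)\<close> form a generic
  family, and the pre-stack condition holds because \<open>{(\<phi> (e m), \<psi> (e m))}\<close> and \<open>{(\<phi> n, \<psi> n)}\<close> are the
  same relation for surjective \<open>e\<close>. Conversely, from a generic family let \<open>R i j\<close> consist of the
  \<open>r \<subseteq> A i \<times> A j\<close> such that \<open>f\<^sup>*\<iota> i \<le> g\<^sup>*\<iota> j\<close> for every span \<open>(f, g)\<close> factoring through \<open>r\<close>. If
  \<open>f\<^sup>*\<iota> i \<le> g\<^sup>*\<iota> j\<close> holds for one span on \<open>M\<close>, then the pre-stack condition for the surjection from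
  \<open>M\<close> to the image \<open>r\<close> of \<open>(f, g)\<close> yields the inequality between the pullbacks along the two
  projections of \<open>r\<close>, whence \<open>r \<in> R i j\<close>.
\<close>

section \<open>Arrows over a given base arrow, and general facts on functors\<close>

definition over ::
  "('o, 'a) cat \<Rightarrow> ('o, 'a, 'p, 'b) fctr \<Rightarrow> 'o \<Rightarrow> 'b \<Rightarrow> 'o \<Rightarrow> bool" where
  "over E P X u Y \<longleftrightarrow> (\<exists>f \<in> hom E X Y. onarr P f = u)"

text \<open>For faithful \<open>P\<close> the arrow chosen here is the only one over
  \<open>u\<close>, so equations between chosen arrows can be checked in the base.\<close>

definition lift ::
  "('o, 'a) cat \<Rightarrow> ('o, 'a, 'p, 'b) fctr \<Rightarrow> 'o \<Rightarrow> 'b \<Rightarrow> 'o \<Rightarrow> 'a" where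
  "lift E P X u Y = (SOME f. f \<in> hom E X Y \<and> onarr P f = u)"

lemma lift:
  assumes "over E P X u Y"
  shows "lift E P X u Y \<in> hom E X Y" "onarr P (lift E P X u Y) = u"
proof -
  have "\<exists>f. f \<in> hom E X Y \<and> onarr P f = u"
    using assms by (auto simp: over_def)
  from someI_ex[OF this]
  show "lift E P X u Y \<in> hom E X Y" "onarr P (lift E P X u Y) = u"
    by (auto simp: lift_def)
qed

lemma (in category) hom_obj:
  assumes "f \<in> hom C X Y"
  shows "X \<in> obj C" "Y \<in> obj C"
  using assms src_obj tgt_obj by (auto simp: hom_def)

lemma arr_hom: "f \<in> arr C \<Longrightarrow> f \<in> hom C (src C f) (tgt C f)"
  by (simp add: hom_def)

lemma is_functor_id: "category C \<Longrightarrow> is_functor C C id_fctr"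
  by (intro is_functor.intro is_functor_axioms.intro) (simp_all add: id_fctr_def)

lemma is_functor_comp:
  assumes "is_functor C D F" "is_functor D E G"
  shows "is_functor C E (comp_fctr G F)"
proof -
  interpret F: is_functor C D F by fact
  interpret G: is_functor D E G by fact
  show ?thesis
  proof
    fix f g X Y Z
    assume "f \<in> hom C X Y" "g \<in> hom C Y Z"
    then show "onarr (comp_fctr G F) (cmp C g f)
        = cmp E (onarr (comp_fctr G F) g) (onarr (comp_fctr G F) f)"
      using G.onarr_cmp[OF F.onarr_hom F.onarr_hom] by (simp add: comp_fctr_def F.onarr_cmp)
  qed (simp_all add: comp_fctr_def F.onobj_obj G.onobj_obj F.onarr_hom G.onarr_hom
      F.onarr_ide G.onarr_ide)
qed


section \<open>Faithful functors\<close>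

locale faithful_over = is_functor E B P
  for B :: "('p, 'b) cat" and E :: "('o, 'a) cat" and P :: "('o, 'a, 'p, 'b) fctr" +
  assumes faithful: "faithful E P"
begin

lemma arr_eqI: "f \<in> hom E X Y \<Longrightarrow> g \<in> hom E X Y \<Longrightarrow> onarr P f = onarr P g \<Longrightarrow> f = g"
  using faithful by (auto simp: faithful_def inj_on_def)

lemma overI: "f \<in> hom E X Y \<Longrightarrow> over E P X (onarr P f) Y"
  by (auto simp: over_def)

lemma over_obj:
  assumes "over E P X u Y"
  shows "X \<in> obj E" "Y \<in> obj E" "u \<in> hom B (onobj P X) (onobj P Y)"
  using assms onarr_hom source.hom_obj by (auto simp: over_def)

lemma over_ide: "X \<in> obj E \<Longrightarrow> over E P X (ide B (onobj P X)) X"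
  using source.ide_hom onarr_ide by (force simp: over_def)

lemma over_comp: "over E P X u Y \<Longrightarrow> over E P Y v Z \<Longrightarrow> over E P X (cmp B v u) Z"
  unfolding over_def by (auto intro!: bexI[OF _ source.cmp_hom] simp: onarr_cmp)

lemma over_vertical_left:
  "over E P X (ide B M) Y \<Longrightarrow> over E P Y u Z \<Longrightarrow> M = onobj P Y \<Longrightarrow> over E P X u Z"
  using over_comp[of X "ide B M" Y u Z] target.cmp_ide_right[OF over_obj(3)] by auto

lemma over_vertical_right:
  "over E P X u Y \<Longrightarrow> over E P Y (ide B M) Z \<Longrightarrow> M = onobj P Y \<Longrightarrow> over E P X u Z"
  using over_comp[of X u Y "ide B M" Z] target.cmp_ide_left[OF over_obj(3)] by auto

text \<open>Faithfulness supplies both the uniqueness of a filler \<open>h\<close> and the equation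
  \<open>cmp E f h = g\<close>, since the two sides lie over the same base arrow. What remains of
  cartesianness is the existence of an arrow over \<open>w\<close>.\<close>

lemma cartesian_iff:
  assumes f: "f \<in> hom E X Y"
  shows "cartesian B E P f \<longleftrightarrow>
    (\<forall>Z w. w \<in> hom B (onobj P Z) (onobj P X) \<longrightarrow> over E P Z (cmp B (onarr P f) w) Y \<longrightarrow>
      over E P Z w X)" (is "_ \<longleftrightarrow> ?R")
proof
  assume c: "cartesian B E P f"
  show ?R
  proof (intro allI impI)
    fix Z w
    assume w: "w \<in> hom B (onobj P Z) (onobj P X)" and o: "over E P Z (cmp B (onarr P f) w) Y"
    then obtain g where "g \<in> hom E Z Y" "cmp B (onarr P f) w = onarr P g"
      by (fastforce simp: over_def)
    moreover have "Z \<in> obj E" using over_obj[OF o] by simp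
    ultimately show "over E P Z w X"
      using c w f unfolding cartesian_def over_def hom_def[of E X Y] by blast
  qed
next
  assume R: ?R
  show "cartesian B E P f"
    unfolding cartesian_def
  proof (intro conjI ballI impI)
    show "f \<in> arr E" using f by (simp add: hom_def)
    fix Z g w
    assume g: "g \<in> hom E Z (tgt E f)" and w: "w \<in> hom B (onobj P Z) (onobj P (src E f))"
      and eq: "cmp B (onarr P f) w = onarr P g"
    have st: "src E f = X" "tgt E f = Y" using f by (auto simp: hom_def)
    have "over E P Z w X" using R w g eq overI[of g Z Y] by (simp add: st)
    then obtain h where h: "h \<in> hom E Z X" "onarr P h = w" by (auto simp: over_def)
    have "cmp E f h = g"
      by (rule arr_eqI[of _ Z Y]) (use g h f eq st source.cmp_hom onarr_cmp in auto)
    then show "\<exists>!h. h \<in> hom E Z (src E f) \<and> onarr P h = w \<and> cmp E f h = g"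
      using h arr_eqI by (auto simp: st)
  qed
qed

section \<open>Fibre order and reindexing in terms of arrows over the base\<close>

lemma fiber_le_iff:
  "fiber_le B E P M X Y \<longleftrightarrow> onobj P X = M \<and> onobj P Y = M \<and> over E P X (ide B M) Y"
  using over_obj[of X "ide B M" Y] by (auto simp: fiber_le_def fiber_def over_def)

text \<open>The arbitrary choice in \<open>reindex\<close> is harmless: from here on the chosen
  object is accessed only through these properties, which determine it up to vertical
  isomorphism.\<close>

lemma reindex:
  assumes fib: "fibration B E P" and X: "X \<in> obj E" and u: "u \<in> hom B J (onobj P X)"
  shows "over E P (reindex B E P u X) u X"
    and "\<And>Y w. w \<in> hom B (onobj P Y) J \<Longrightarrow> over E P Y (cmp B u w) X \<Longrightarrow>
      over E P Y w (reindex B E P u X)"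
    and "onobj P (reindex B E P u X) = J"
proof -
  let ?X = "reindex B E P u X"
  have "J \<in> obj B" using target.hom_obj(1)[OF u] .
  then obtain f where "f \<in> arr E" "tgt E f = X" "onarr P f = u" "cartesian B E P f"
    using fib X u unfolding fibration_def by blast
  then have "\<exists>X'. \<exists>f \<in> hom E X' X. onarr P f = u \<and> cartesian B E P f"
    using arr_hom[of f E] by auto
  then have "\<exists>f \<in> hom E ?X X. onarr P f = u \<and> cartesian B E P f"
    unfolding reindex_def by (rule someI_ex)
  then obtain f where
    f: "f \<in> hom E ?X X" "onarr P f = u" "cartesian B E P f"
    by blast
  show "over E P ?X u X" using f by (auto simp: over_def)
  then show J: "onobj P ?X = J"
    using over_obj(3)[of ?X u X] u by (simp add: hom_def)
  show "over E P Y w ?X" if "w \<in> hom B (onobj P Y) J" "over E P Y (cmp B u w) X" for Y w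
    using f(3) that unfolding cartesian_iff[OF f(1)] f(2) J by blast
qed

end


section \<open>Equivalences as maps on objects\<close>

text \<open>Vertical arrows in both directions between \<open>X\<close> and \<open>G (F X)\<close>
  amount to an isomorphism when \<open>P\<close> is faithful. The condition is asymmetric in
  \<open>F\<close> and \<open>G\<close>; an equivalence consists of two instances with the roles
  exchanged.\<close>

definition half_equivalence ::
  "('p, 'b) cat \<Rightarrow> ('o, 'a) cat \<Rightarrow> ('o, 'a, 'p, 'b) fctr \<Rightarrow>
   ('q, 'c) cat \<Rightarrow> ('q, 'c, 'p, 'b) fctr \<Rightarrow> ('o \<Rightarrow> 'q) \<Rightarrow> ('q \<Rightarrow> 'o) \<Rightarrow> bool" where
  "half_equivalence B E P E' P' F G \<longleftrightarrow>
    (\<forall>X \<in> obj E. F X \<in> obj E' \<and> onobj P' (F X) = onobj P X \<and>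
      over E P X (ide B (onobj P X)) (G (F X)) \<and> over E P (G (F X)) (ide B (onobj P X)) X) \<and>
    (\<forall>X u Y. over E P X u Y \<longrightarrow> over E' P' (F X) u (F Y))"

lemma half_equivalenceD:
  assumes "half_equivalence B E P E' P' F G"
  shows "X \<in> obj E \<Longrightarrow> F X \<in> obj E'"
    and "X \<in> obj E \<Longrightarrow> onobj P' (F X) = onobj P X"
    and "X \<in> obj E \<Longrightarrow> over E P X (ide B (onobj P X)) (G (F X))"
    and "X \<in> obj E \<Longrightarrow> over E P (G (F X)) (ide B (onobj P X)) X"
    and "over E P X u Y \<Longrightarrow> over E' P' (F X) u (F Y)"
  using assms by (auto simp: half_equivalence_def)

definition lift_fctr ::
  "('o, 'a) cat \<Rightarrow> ('o, 'a, 'p, 'b) fctr \<Rightarrow> ('q, 'c) cat \<Rightarrow> ('q, 'c, 'p, 'b) fctr \<Rightarrow>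
   ('o \<Rightarrow> 'q) \<Rightarrow> ('o, 'a, 'q, 'c) fctr" where
  "lift_fctr E P E' P' F =
    \<lparr>onobj = F, onarr = (\<lambda>f. lift E' P' (F (src E f)) (onarr P f) (F (tgt E f)))\<rparr>"

text \<open>Functoriality follows from faithfulness. For cartesian \<open>f\<close> from
  \<open>X\<close> to \<open>Y\<close>, an arrow from \<open>Z\<close> to \<open>F Y\<close> is sent
  by \<open>G\<close> to one from \<open>G Z\<close> to \<open>G (F Y)\<close> and on to
  \<open>Y\<close>, which factors through \<open>f\<close>. Applying \<open>F\<close> to the factor
  and precomposing with \<open>Z\<close> to \<open>F (G Z)\<close> gives the required arrow into
  \<open>F X\<close>.\<close>

lemma fibered_functor_lift_fctr:
  assumes E: "faithful_over B E P" and E': "faithful_over B E' P'"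
    and FG: "half_equivalence B E P E' P' F G" and GF: "half_equivalence B E' P' E P G F"
  shows "fibered_functor B E P E' P' (lift_fctr E P E' P' F)"
proof -
  interpret E: faithful_over B E P by fact
  interpret E': faithful_over B E' P' by fact
  note FG = half_equivalenceD[OF FG] and GF = half_equivalenceD[OF GF]
  let ?F = "lift_fctr E P E' P' F"
  have F: "onarr ?F f \<in> hom E' (F X) (F Y)" "onarr P' (onarr ?F f) = onarr P f"
    if f: "f \<in> hom E X Y" for f X Y
  proof -
    have "src E f = X" "tgt E f = Y" using f by (auto simp: hom_def)
    then show "onarr ?F f \<in> hom E' (F X) (F Y)" "onarr P' (onarr ?F f) = onarr P f"
      using lift[OF FG(5)[OF E.overI[OF f]]] by (simp_all add: lift_fctr_def)
  qed
  have [simp]: "onobj ?F X = F X" for X by (simp add: lift_fctr_def)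
  have "is_functor E E' ?F"
  proof
    fix X assume X: "X \<in> obj E"
    note i = E.source.ide_hom[OF X]
    show "onarr ?F (ide E X) = ide E' (onobj ?F X)"
      using E'.arr_eqI[OF F(1)[OF i] E'.source.ide_hom[OF FG(1)[OF X]]]
      by (simp add: F(2)[OF i] E.onarr_ide[OF X] E'.onarr_ide[OF FG(1)[OF X]] FG(2)[OF X])
  next
    fix f g X Y Z assume f: "f \<in> hom E X Y" and g: "g \<in> hom E Y Z"
    note gf = E.source.cmp_hom[OF f g]
    note k = F(1)[OF f] F(1)[OF g]
    show "onarr ?F (cmp E g f) = cmp E' (onarr ?F g) (onarr ?F f)"
      by (rule E'.arr_eqI[OF F(1)[OF gf] E'.source.cmp_hom[OF k]])
        (simp add: E'.onarr_cmp[OF k] F(2)[OF gf] F(2)[OF f] F(2)[OF g] E.onarr_cmp[OF f g])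
  qed (simp_all add: FG(1) F(1))
  moreover have "cartesian B E' P' (onarr ?F f)" if c: "cartesian B E P f" for f
  proof -
    obtain X Y where f: "f \<in> hom E X Y"
      using c arr_hom[of f E] by (auto simp: cartesian_def)
    note XY = E.source.hom_obj[OF f]
    show ?thesis
      unfolding E'.cartesian_iff[OF F(1)[OF f]] F(2)[OF f]
    proof (intro allI impI)
      fix Z w
      assume w: "w \<in> hom B (onobj P' Z) (onobj P' (F X))"
        and Z: "over E' P' Z (cmp B (onarr P f) w) (F Y)"
      note Zo = E'.over_obj(1)[OF Z]
      have "over E P (G Z) (cmp B (onarr P f) w) Y"
        using E.over_vertical_right[OF GF(5)[OF Z] FG(4)[OF XY(2)]]
          FG(1,2)[OF XY(2)] GF(2) by simp
      then have "over E P (G Z) w X"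
        using c w unfolding E.cartesian_iff[OF f] GF(2)[OF Zo, symmetric] FG(2)[OF XY(1)]
        by blast
      from E'.over_vertical_left[OF GF(3)[OF Zo] FG(5)[OF this]]
      show "over E' P' Z w (F X)" using Zo GF(1,2) FG(2) by simp
    qed
  qed
  ultimately show ?thesis
    using F(2)[OF arr_hom] FG(2) unfolding fibered_functor_def by simp
qed

section \<open>Vertical natural isomorphisms\<close>

text \<open>Components and inverses are chosen over identities. The inverse laws and naturality then
  hold because both sides of each equation are parallel and have the same image under
  \<open>P\<close>. Keeping \<open>H\<close> and \<open>K\<close> general serves the unit and the
  counit alike.\<close>

lemma ex_vertical_nat_iso:
  assumes E: "faithful_over B E P" and H: "is_functor D E H" and K: "is_functor D E K"
    and arr: "\<And>f. f \<in> arr D \<Longrightarrow> onarr P (onarr H f) = onarr P (onarr K f)"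
    and ob: "\<And>X. X \<in> obj D \<Longrightarrow> onobj P (onobj H X) = onobj P (onobj K X)"
    and HK: "\<And>X. X \<in> obj D \<Longrightarrow> over E P (onobj H X) (ide B (onobj P (onobj H X))) (onobj K X)"
    and KH: "\<And>X. X \<in> obj D \<Longrightarrow> over E P (onobj K X) (ide B (onobj P (onobj H X))) (onobj H X)"
  shows "\<exists>\<eta>. vertical_nat_iso B D E P H K \<eta>"
proof -
  interpret E: faithful_over B E P by fact
  interpret H: is_functor D E H by fact
  interpret K: is_functor D E K by fact
  define \<eta> where "\<eta> X = lift E P (onobj H X) (ide B (onobj P (onobj H X))) (onobj K X)" for X
  define \<theta> where "\<theta> X = lift E P (onobj K X) (ide B (onobj P (onobj H X))) (onobj H X)" for X
  note \<eta> = lift[OF HK, folded \<eta>_def] and \<theta> = lift[OF KH, folded \<theta>_def]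
  have "vertical_nat_iso B D E P H K \<eta>"
    unfolding vertical_nat_iso_def
  proof (intro conjI ballI allI)
    fix X assume X: "X \<in> obj D"
    show "\<eta> X \<in> hom E (onobj H X) (onobj K X)" "onarr P (\<eta> X) = ide B (onobj P (onobj H X))"
      using \<eta>[OF X] by auto
    have st: "\<eta> X \<in> arr E" "src E (\<eta> X) = onobj H X" "tgt E (\<eta> X) = onobj K X"
      using \<eta>[OF X] by (auto simp: hom_def)
    note HX = H.onobj_obj[OF X] and KX = K.onobj_obj[OF X]
    have ii: "cmp B (ide B (onobj P (onobj H X))) (ide B (onobj P (onobj H X)))
      = ide B (onobj P (onobj H X))"
      using E.target.cmp_ide_left[OF E.target.ide_hom[OF E.onobj_obj[OF HX]]] .
    have "cmp E (\<theta> X) (\<eta> X) = ide E (onobj H X)"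
      by (rule E.arr_eqI[OF E.source.cmp_hom[OF \<eta>(1)[OF X] \<theta>(1)[OF X]] E.source.ide_hom[OF HX]])
        (simp add: E.onarr_cmp[OF \<eta>(1)[OF X] \<theta>(1)[OF X]] \<eta>(2)[OF X] \<theta>(2)[OF X]
          E.onarr_ide[OF HX] ii)
    moreover have "cmp E (\<eta> X) (\<theta> X) = ide E (onobj K X)"
      by (rule E.arr_eqI[OF E.source.cmp_hom[OF \<theta>(1)[OF X] \<eta>(1)[OF X]] E.source.ide_hom[OF KX]])
        (simp add: E.onarr_cmp[OF \<theta>(1)[OF X] \<eta>(1)[OF X]] \<eta>(2)[OF X] \<theta>(2)[OF X]
          E.onarr_ide[OF KX] ii ob[OF X, symmetric])
    ultimately show "iso_arr E (\<eta> X)"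
      using \<theta>(1)[OF X] st unfolding iso_arr_def by auto
  next
    fix X Y f assume f: "f \<in> hom D X Y"
    note XY = H.source.hom_obj[OF f]
    have Pf: "onarr P (onarr H f) = onarr P (onarr K f)"
      using arr f by (simp add: hom_def)
    note l = \<eta>(1)[OF XY(1)] K.onarr_hom[OF f] and r = H.onarr_hom[OF f] \<eta>(1)[OF XY(2)]
    show "cmp E (onarr K f) (\<eta> X) = cmp E (\<eta> Y) (onarr H f)"
    proof (rule E.arr_eqI[OF E.source.cmp_hom[OF l] E.source.cmp_hom[OF r]])
      have u: "onarr P (onarr K f) \<in> hom B (onobj P (onobj H X)) (onobj P (onobj H Y))"
        using E.onarr_hom[OF r(1)] Pf by simp
      show "onarr P (cmp E (onarr K f) (\<eta> X)) = onarr P (cmp E (\<eta> Y) (onarr H f))"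
        by (simp add: E.onarr_cmp[OF l] E.onarr_cmp[OF r] \<eta>(2)[OF XY(1)] \<eta>(2)[OF XY(2)] Pf
            E.target.cmp_ide_left[OF u] E.target.cmp_ide_right[OF u])
    qed
  qed
  then show ?thesis by blast
qed

lemma fibered_equivalentI:
  assumes E: "faithful_over B E P" and E': "faithful_over B E' P'"
    and FG: "half_equivalence B E P E' P' F G" and GF: "half_equivalence B E' P' E P G F"
  shows "fibered_equivalent B E P E' P'"
proof -
  interpret E: faithful_over B E P by fact
  interpret E': faithful_over B E' P' by fact
  let ?F = "lift_fctr E P E' P' F" and ?G = "lift_fctr E' P' E P G"
  note F = fibered_functor_lift_fctr[OF E E' FG GF]
  note G = fibered_functor_lift_fctr[OF E' E GF FG]
  note FG = half_equivalenceD[OF FG] and GF = half_equivalenceD[OF GF]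
  have Ff: "is_functor E E' ?F" and Gf: "is_functor E' E ?G"
    using F G by (auto simp: fibered_functor_def)
  have o [simp]: "onobj ?F X = F X" "onobj ?G Y = G Y" for X Y by (auto simp: lift_fctr_def)
  have aF: "onarr ?F f \<in> arr E'" if "f \<in> arr E" for f
    using is_functor.onarr_hom[OF Ff arr_hom[OF that]] by (simp add: hom_def)
  have aG: "onarr ?G f \<in> arr E" if "f \<in> arr E'" for f
    using is_functor.onarr_hom[OF Gf arr_hom[OF that]] by (simp add: hom_def)
  have P: "onarr P' (onarr ?F f) = onarr P f" if "f \<in> arr E" for f
    using F that by (auto simp: fibered_functor_def)
  have P': "onarr P (onarr ?G f) = onarr P' f" if "f \<in> arr E'" for f
    using G that by (auto simp: fibered_functor_def)
  have "\<exists>\<eta>. vertical_nat_iso B E E P id_fctr (comp_fctr ?G ?F) \<eta>"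
    by (rule ex_vertical_nat_iso[OF E is_functor_id[OF E.source.category_axioms]
          is_functor_comp[OF Ff Gf]])
      (simp_all add: id_fctr_def comp_fctr_def FG GF P P' aF)
  moreover have "\<exists>\<epsilon>. vertical_nat_iso B E' E' P' (comp_fctr ?F ?G) id_fctr \<epsilon>"
    by (rule ex_vertical_nat_iso[OF E' is_functor_comp[OF Gf Ff]
          is_functor_id[OF E'.source.category_axioms]])
      (simp_all add: id_fctr_def comp_fctr_def FG GF P P' aG)
  ultimately show ?thesis
    using F G unfolding fibered_equivalent_def by blast
qed

text \<open>The inverse \<open>g\<close> of a component is again vertical: projecting
  \<open>cmp E g (\<eta> X)\<close> to the base gives \<open>onarr P g\<close> composed with an
  identity, and the result is an identity. The hypothesis \<open>ob\<close> gives
  \<open>onarr P g\<close> the source at which this identity cancels.\<close>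

lemma vertical_nat_iso_over:
  assumes E: "faithful_over B E P" and v: "vertical_nat_iso B D E P H K \<eta>" and X: "X \<in> obj D"
    and ob: "onobj P (onobj K X) = onobj P (onobj H X)"
  shows "over E P (onobj H X) (ide B (onobj P (onobj H X))) (onobj K X)"
    and "over E P (onobj K X) (ide B (onobj P (onobj H X))) (onobj H X)"
proof -
  interpret E: faithful_over B E P by fact
  have \<eta>: "\<eta> X \<in> hom E (onobj H X) (onobj K X)" "iso_arr E (\<eta> X)"
    "onarr P (\<eta> X) = ide B (onobj P (onobj H X))"
    using v X by (auto simp: vertical_nat_iso_def)
  then show "over E P (onobj H X) (ide B (onobj P (onobj H X))) (onobj K X)"
    by (auto simp: over_def)
  have "src E (\<eta> X) = onobj H X" "tgt E (\<eta> X) = onobj K X" using \<eta> by (auto simp: hom_def)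
  then obtain g where g: "g \<in> hom E (onobj K X) (onobj H X)"
    "cmp E g (\<eta> X) = ide E (onobj H X)"
    using \<eta>(2) by (auto simp: iso_arr_def)
  have "cmp B (onarr P g) (ide B (onobj P (onobj H X))) = ide B (onobj P (onobj H X))"
    using E.onarr_cmp[OF \<eta>(1) g(1)] g(2) \<eta>(3) E.onarr_ide E.source.hom_obj[OF \<eta>(1)] by simp
  moreover have "onarr P g \<in> hom B (onobj P (onobj H X)) (onobj P (onobj H X))"
    using E.onarr_hom[OF g(1)] ob by simp
  ultimately have "onarr P g = ide B (onobj P (onobj H X))"
    using E.target.cmp_ide_right by metis
  then show "over E P (onobj K X) (ide B (onobj P (onobj H X))) (onobj H X)"
    using g by (auto simp: over_def)
qed

lemma fibered_functor_over:
  assumes "fibered_functor B E P E' P' F" "over E P X u Y"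
  shows "over E' P' (onobj F X) u (onobj F Y)"
proof -
  obtain f where f: "f \<in> hom E X Y" "onarr P f = u" using assms(2) by (auto simp: over_def)
  then have "onarr F f \<in> hom E' (onobj F X) (onobj F Y)"
    using assms(1) is_functor.onarr_hom[of E E' F f X Y] by (auto simp: fibered_functor_def)
  moreover have "onarr P' (onarr F f) = u"
    using f assms(1) by (auto simp: fibered_functor_def hom_def)
  ultimately show ?thesis by (auto simp: over_def)
qed

lemma fibered_equivalentE:
  assumes E: "faithful_over B E P" and E': "faithful_over B E' P'"
    and "fibered_equivalent B E P E' P'"
  obtains F G where "half_equivalence B E P E' P' F G" "half_equivalence B E' P' E P G F"
proof -
  obtain F G \<eta> \<epsilon> where F: "fibered_functor B E P E' P' F" and G: "fibered_functor B E' P' E P G"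
    and \<eta>: "vertical_nat_iso B E E P id_fctr (comp_fctr G F) \<eta>"
    and \<epsilon>: "vertical_nat_iso B E' E' P' (comp_fctr F G) id_fctr \<epsilon>"
    using assms(3) unfolding fibered_equivalent_def by blast
  have F': "onobj F X \<in> obj E'" "onobj P' (onobj F X) = onobj P X" if "X \<in> obj E" for X
    using F that is_functor.onobj_obj by (auto simp: fibered_functor_def)
  have G': "onobj G X \<in> obj E" "onobj P (onobj G X) = onobj P' X" if "X \<in> obj E'" for X
    using G that is_functor.onobj_obj by (auto simp: fibered_functor_def)
  have "half_equivalence B E P E' P' (onobj F) (onobj G)"
    unfolding half_equivalence_def
    using vertical_nat_iso_over[OF E \<eta>] F' G' fibered_functor_over[OF F]
    by (auto simp: id_fctr_def comp_fctr_def)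
  moreover have "half_equivalence B E' P' E P (onobj G) (onobj F)"
    unfolding half_equivalence_def
    using vertical_nat_iso_over[OF E' \<epsilon>] F' G' fibered_functor_over[OF G]
    by (auto simp: id_fctr_def comp_fctr_def)
  ultimately show ?thesis by (rule that)
qed


section \<open>Sets and families\<close>

lemma hom_SET: "t \<in> hom (SET U) M N \<longleftrightarrow> (\<exists>f. t = (M, f, N) \<and> M \<in> U \<and> N \<in> U \<and> f \<in> M \<rightarrow>\<^sub>E N)"
  by (auto simp: hom_def SET_def)

lemma SET_simps [simp]:
  "obj (SET U) = U"
  "ide (SET U) M = (M, restrict (\<lambda>x. x) M, M)"
  "cmp (SET U) (M', g, N') (M, f, N) = (M, compose M g f, N')"
  by (simp_all add: SET_def)

lemma restrict_id_PiE [simp]: "restrict (\<lambda>x. x) M \<in> M \<rightarrow>\<^sub>E M"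
  by auto

lemma compose_PiE: "f \<in> M \<rightarrow>\<^sub>E N \<Longrightarrow> g \<in> N \<rightarrow>\<^sub>E K \<Longrightarrow> compose M g f \<in> M \<rightarrow>\<^sub>E K"
  by (auto simp: compose_def)

lemma compose_id_left: "f \<in> M \<rightarrow>\<^sub>E N \<Longrightarrow> compose M (restrict (\<lambda>x. x) N) f = f"
  by (auto simp: compose_def fun_eq_iff PiE_iff extensional_def)

lemma compose_id_right: "f \<in> M \<rightarrow>\<^sub>E N \<Longrightarrow> compose M f (restrict (\<lambda>x. x) M) = f"
  by (auto simp: compose_def fun_eq_iff PiE_iff extensional_def)

section \<open>The total category of a uniform preorder\<close>

lemma hom_ufam:
  "t \<in> hom (ufam U I A R) (M, i, f) (N, j, g) \<longleftrightarrow>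
    (\<exists>u. t = ((M, i, f), u, (N, j, g)) \<and> M \<in> U \<and> N \<in> U \<and> i \<in> I \<and> j \<in> I \<and>
      f \<in> M \<rightarrow>\<^sub>E A i \<and> g \<in> N \<rightarrow>\<^sub>E A j \<and> u \<in> M \<rightarrow>\<^sub>E N \<and> {(f m, g (u m)) | m. m \<in> M} \<in> R i j)"
proof -
  have "{(f m, compose M g u m) | m. m \<in> M} = {(f m, g (u m)) | m. m \<in> M}" for u
    by (auto simp: compose_def)
  then show ?thesis
    by (auto simp: hom_def ufam_def total_cat_def ufam_preds_def ufam_le_def ufam_reindex_def)
qed

lemma ufam_simps [simp]:
  "(M, i, f) \<in> obj (ufam U I A R) \<longleftrightarrow> M \<in> U \<and> i \<in> I \<and> f \<in> M \<rightarrow>\<^sub>E A i"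
  "ide (ufam U I A R) X = (X, restrict (\<lambda>x. x) (fst X), X)"
  "cmp (ufam U I A R) (Y', v, Z) (X, u, Y) = (X, compose (fst X) v u, Z)"
  by (simp_all add: ufam_def total_cat_def ufam_preds_def)

lemma total_proj_simps [simp]:
  "onobj total_proj X = fst X"
  "onarr total_proj (X, u, Y) = (fst X, u, fst Y)"
  by (simp_all add: total_proj_def)

lemma over_ufam:
  "over (ufam U I A R) total_proj (M, i, f) t (N, j, g) \<longleftrightarrow>
    (\<exists>u. t = (M, u, N) \<and> M \<in> U \<and> N \<in> U \<and> i \<in> I \<and> j \<in> I \<and>
      f \<in> M \<rightarrow>\<^sub>E A i \<and> g \<in> N \<rightarrow>\<^sub>E A j \<and> u \<in> M \<rightarrow>\<^sub>E N \<and> {(f m, g (u m)) | m. m \<in> M} \<in> R i j)"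
  unfolding over_def Bex_def hom_ufam by auto

context uniform_preorder
begin

text \<open>For identities, the image relation lies in the diagonal. For composites, it lies in the
  relational composite of the two given images. In both cases closure under subsets finishes the
  argument.\<close>

lemma category_ufam: "category (ufam U I A R)"
proof
  fix X assume "X \<in> obj (ufam U I A R)"
  moreover obtain M i f where X: "X = (M, i, f)" using prod_cases3 by blast
  ultimately have o: "M \<in> U" "i \<in> I" "f \<in> M \<rightarrow>\<^sub>E A i" by auto
  then have "{(f m, f (restrict (\<lambda>x. x) M m)) | m. m \<in> M} \<in> R i i"
    by (intro rel_down[OF _ _ rel_id]) auto
  then show "ide (ufam U I A R) X \<in> hom (ufam U I A R) X X"
    using o by (auto simp: X hom_ufam)
next
  fix s t X Y Z
  assume st: "s \<in> hom (ufam U I A R) X Y" "t \<in> hom (ufam U I A R) Y Z"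
  obtain M i f N j g K k h where X: "X = (M, i, f)" "Y = (N, j, g)" "Z = (K, k, h)"
    using prod_cases3 by metis
  obtain u v where u: "s = (X, u, Y)" "u \<in> M \<rightarrow>\<^sub>E N" "{(f m, g (u m)) | m. m \<in> M} \<in> R i j"
    and v: "t = (Y, v, Z)" "v \<in> N \<rightarrow>\<^sub>E K" "{(g m, h (v m)) | m. m \<in> N} \<in> R j k"
    and o: "i \<in> I" "j \<in> I" "k \<in> I"
    using st by (auto simp: hom_ufam X)
  have "{(f m, h (compose M v u m)) | m. m \<in> M} \<in> R i k"
  proof (rule rel_down[OF o(1) o(3) rel_comp[OF o u(3) v(3)]])
    show "{(f m, h (compose M v u m)) | m. m \<in> M}
        \<subseteq> {(f m, g (u m)) | m. m \<in> M} O {(g m, h (v m)) | m. m \<in> N}"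
      using u(2) by (fastforce simp: compose_def)
  qed
  then show "cmp (ufam U I A R) t s \<in> hom (ufam U I A R) X Z"
    using st compose_PiE[OF u(2) v(2)] by (auto simp: X u v hom_ufam)
next
  fix s X Y assume s: "s \<in> hom (ufam U I A R) X Y"
  obtain M i f N j g where X: "X = (M, i, f)" "Y = (N, j, g)" using prod_cases3 by metis
  show "cmp (ufam U I A R) s (ide (ufam U I A R) X) = s"
    "cmp (ufam U I A R) (ide (ufam U I A R) Y) s = s"
    using s by (auto simp: X hom_ufam compose_id_left compose_id_right)
next
  fix s t r X Y Z W
  assume st: "s \<in> hom (ufam U I A R) W X" "t \<in> hom (ufam U I A R) X Y"
    "r \<in> hom (ufam U I A R) Y Z"
  obtain M i f N j g K k h L l p where
    X: "W = (M, i, f)" "X = (N, j, g)" "Y = (K, k, h)" "Z = (L, l, p)"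
    using prod_cases3 by metis
  show "cmp (ufam U I A R) r (cmp (ufam U I A R) t s) = cmp (ufam U I A R) (cmp (ufam U I A R) r t) s"
    using st by (auto simp: X hom_ufam compose_def fun_eq_iff PiE_iff Pi_iff)
qed (auto simp: ufam_def total_cat_def)

text \<open>An arrow of \<open>ufam\<close> is determined by its endpoints and its underlying map.
  That \<open>SET U\<close> is a category is a hypothesis here; in the applications it comes from
  the given fibration, whose base it is.\<close>

lemma faithful_over_ufam:
  assumes "category (SET U)"
  shows "faithful_over (SET U) (ufam U I A R) total_proj"
proof (intro faithful_over.intro is_functor.intro category_ufam assms is_functor_axioms.intro
    faithful_over_axioms.intro)
  show "faithful (ufam U I A R) total_proj"
    unfolding faithful_def inj_on_def
    by (auto simp: hom_ufam)
qed (auto simp: hom_ufam hom_SET)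

end


section \<open>From an equivalence to a generic family\<close>

locale fibered_preorder_over_sets =
  fixes U :: "'u set set" and E :: "('o, 'a) cat" and P :: "('o, 'a, 'u set, 'u set_arr) fctr"
  assumes universe: "set_universe U"
    and fibered_preorder: "fibered_preorder U E P"

sublocale fibered_preorder_over_sets \<subseteq> faithful_over "SET U" E P
  using fibered_preorder
  by (auto simp: fibered_preorder_def fibration_def faithful_over_def faithful_over_axioms_def)

context fibered_preorder_over_sets
begin

lemma fib: "fibration (SET U) E P"
  using fibered_preorder by (simp add: fibered_preorder_def)

abbreviation rdx where "rdx M f N X \<equiv> reindex (SET U) E P (M, f, N) X"

text \<open>The equivalence is the universal property of the cartesian lift: composition with the
  lift in one direction, factorization through it in the other.\<close>

lemma rdx:
  assumes "X \<in> obj E" "M \<in> U" "f \<in> M \<rightarrow>\<^sub>E onobj P X"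
  shows "over E P (rdx M f (onobj P X) X) (M, f, onobj P X) X"
    and "onobj P (rdx M f (onobj P X) X) = M"
    and "rdx M f (onobj P X) X \<in> obj E"
    and "over E P Y (onobj P Y, w, M) (rdx M f (onobj P X) X) \<longleftrightarrow>
      Y \<in> obj E \<and> w \<in> onobj P Y \<rightarrow>\<^sub>E M \<and>
      over E P Y (onobj P Y, compose (onobj P Y) f w, onobj P X) X" (is "?l \<longleftrightarrow> ?r")
proof -
  have u: "(M, f, onobj P X) \<in> hom (SET U) M (onobj P X)"
    using assms onobj_obj by (auto simp: hom_SET)
  note r = reindex[OF fib assms(1) u]
  show 1: "over E P (rdx M f (onobj P X) X) (M, f, onobj P X) X"
    and 2: "onobj P (rdx M f (onobj P X) X) = M"
    by (rule r)+
  show "rdx M f (onobj P X) X \<in> obj E"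
    using over_obj[OF 1] by simp
  show "?l \<longleftrightarrow> ?r"
  proof
    assume l: ?l
    then show ?r using over_comp[OF l 1] over_obj[OF l] by (simp add: hom_SET 2)
  next
    assume ?r
    then show ?l using r(2)[of "(onobj P Y, w, M)" Y] assms onobj_obj by (auto simp: hom_SET)
  qed
qed

text \<open>A vertical arrow into the reindexing of \<open>Y\<close> along \<open>g\<close> is, by
  the universal property, an arrow into \<open>Y\<close> over \<open>g\<close> composed with an
  identity.\<close>

lemma fiber_le_rdx_iff:
  assumes X: "X \<in> obj E" "onobj P X = K" and Y: "Y \<in> obj E" "onobj P Y = N"
    and M: "M \<in> U" and f: "f \<in> M \<rightarrow>\<^sub>E K" and g: "g \<in> M \<rightarrow>\<^sub>E N"
  shows "fiber_le (SET U) E P M (rdx M f K X) (rdx M g N Y) \<longleftrightarrow>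
    over E P (rdx M f K X) (M, g, N) Y"
  using rdx[of X M f] rdx[of Y M g] rdx(4)[of Y M g "rdx M f K X" "restrict (\<lambda>x. x) M"] assms
  by (auto simp: fiber_le_iff compose_id_right)

text \<open>The reindexing of the upper predicate is replaced by an arrow into \<open>Y\<close> over
  \<open>e\<close>, so that only one reindexed object is left to handle. The set \<open>N\<close>
  lies in \<open>U\<close> as the base of \<open>X\<close>.\<close>

lemma prestack_iff:
  "prestack U E P \<longleftrightarrow>
    (\<forall>J N e X Y. J \<in> U \<longrightarrow> e \<in> J \<rightarrow>\<^sub>E N \<longrightarrow> e ` J = N \<longrightarrow> X \<in> obj E \<longrightarrow> onobj P X = N \<longrightarrow>
      Y \<in> obj E \<longrightarrow> onobj P Y = N \<longrightarrow> over E P (rdx J e N X) (J, e, N) Y \<longrightarrow>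
      over E P X (N, restrict (\<lambda>x. x) N, N) Y)"
  (is "_ \<longleftrightarrow> ?r")
proof
  assume ?r
  then show "prestack U E P"
    unfolding prestack_def by (auto simp: fiber_def fiber_le_rdx_iff) (simp add: fiber_le_iff)
next
  assume p: "prestack U E P"
  show ?r
  proof (intro allI impI)
    fix J N e X Y
    assume a: "J \<in> U" "e \<in> J \<rightarrow>\<^sub>E N" "e ` J = N" "X \<in> obj E" "onobj P X = N"
      "Y \<in> obj E" "onobj P Y = N" "over E P (rdx J e N X) (J, e, N) Y"
    then have "fiber_le (SET U) E P N X Y"
      using p onobj_obj[of X] unfolding prestack_def
      by (auto simp: fiber_def fiber_le_rdx_iff)
    then show "over E P X (N, restrict (\<lambda>x. x) N, N) Y" by (simp add: fiber_le_iff)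
  qed
qed

section \<open>Transport along an equivalence with a uniform preorder\<close>

context
  fixes I A R F G
  assumes up: "uniform_preorder U I A R"
    and FG: "half_equivalence (SET U) E P (ufam U I A R) total_proj F G"
    and GF: "half_equivalence (SET U) (ufam U I A R) total_proj E P G F"
begin

interpretation up: uniform_preorder U I A R by (rule up)
interpretation ufam: faithful_over "SET U" "ufam U I A R" total_proj
  by (rule up.faithful_over_ufam) (rule target.category_axioms)

private abbreviation "\<Phi> \<equiv> ufam U I A R"

lemma F_cases:
  assumes "X \<in> obj E"
  obtains i f where "F X = (onobj P X, i, f)" "i \<in> I" "f \<in> onobj P X \<rightarrow>\<^sub>E A i"
proof -
  obtain M i f where F: "F X = (M, i, f)" using prod_cases3 by blast
  have "F X \<in> obj \<Phi>" "onobj total_proj (F X) = onobj P X"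
    using half_equivalenceD[OF FG] assms by auto
  then show ?thesis using that F by auto
qed

text \<open>Applying \<open>G\<close> gives an arrow from \<open>G (F X)\<close> to
  \<open>G (F Y)\<close>; the vertical arrows from \<open>X\<close> to \<open>G (F X)\<close> and
  from \<open>G (F Y)\<close> to \<open>Y\<close> complete it.\<close>

lemma over_F_imp:
  assumes X: "X \<in> obj E" and Y: "Y \<in> obj E" and "over \<Phi> total_proj (F X) u (F Y)"
  shows "over E P X u Y"
proof -
  note FG = half_equivalenceD[OF FG] and GF = half_equivalenceD[OF GF]
  have "over E P (G (F X)) u (G (F Y))" using GF assms by auto
  then have "over E P X u (G (F Y))"
    using over_vertical_left[OF FG(3)[OF X]] GF(2) FG(1,2) X by auto
  then show ?thesis
    using over_vertical_right[OF _ FG(4)[OF Y]] GF(2) FG(1,2) Y by auto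
qed

text \<open>Inside \<open>ufam\<close>, the predicate \<open>(M, i, f)\<close> is the reindexing
  along \<open>f\<close> of \<open>i\<close> with the identity of \<open>A i\<close>. Reading this
  off for \<open>F \<phi>\<close> yields the index and the map for \<open>\<phi>\<close>.\<close>

lemma generic_family_ufam:
  "generic_family U E P I A (\<lambda>i. G (A i, i, restrict (\<lambda>x. x) (A i)))"
  unfolding generic_family_def
proof (intro conjI ballI)
  note FGD = half_equivalenceD[OF FG] and GFD = half_equivalenceD[OF GF]
  let ?X = "\<lambda>i. (A i, i, restrict (\<lambda>x. x) (A i))"
  have X: "?X i \<in> obj \<Phi>" if "i \<in> I" for i
    using that up.carrier_set by auto
  show "I \<in> U" by (rule up.index_set)
  show "A i \<in> U" if "i \<in> I" for i using that up.carrier_set by auto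
  have G: "G (?X i) \<in> obj E" "onobj P (G (?X i)) = A i" if "i \<in> I" for i
    using GFD(1,2)[OF X[OF that]] by auto
  then show "G (?X i) \<in> fiber E P (A i)" if "i \<in> I" for i using that by (simp add: fiber_def)
  fix M \<phi> assume M: "M \<in> U" and "\<phi> \<in> fiber E P M"
  then have \<phi>: "\<phi> \<in> obj E" "onobj P \<phi> = M" by (auto simp: fiber_def)
  obtain i f where F: "F \<phi> = (M, i, f)" "i \<in> I" "f \<in> M \<rightarrow>\<^sub>E A i"
    using F_cases[OF \<phi>(1)] \<phi>(2) by metis
  note G = G[OF F(2)]
  let ?\<psi> = "rdx M f (A i) (G (?X i))"
  have r: "over E P ?\<psi> (M, f, A i) (G (?X i))" "onobj P ?\<psi> = M" "?\<psi> \<in> obj E"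
    "\<And>Y w. over E P Y (onobj P Y, w, M) ?\<psi> \<longleftrightarrow> Y \<in> obj E \<and> w \<in> onobj P Y \<rightarrow>\<^sub>E M \<and>
      over E P Y (onobj P Y, compose (onobj P Y) f w, A i) (G (?X i))"
    using rdx[of "G (?X i)" M f] M F G by auto
  \<comment> \<open>This is the universal property of \<open>(M, i, f)\<close> as a reindexing of
    \<open>?X i\<close>: both conditions concern the same image relation.\<close>
  have iff: "over \<Phi> total_proj (N, j, g) (N, compose N f w, A i) (?X i) \<longleftrightarrow>
    over \<Phi> total_proj (N, j, g) (N, w, M) (M, i, f)" if "w \<in> N \<rightarrow>\<^sub>E M" for N j g w
  proof -
    have "{(g n, restrict (\<lambda>x. x) (A i) (compose N f w n)) |n. n \<in> N} = {(g n, f (w n)) |n. n \<in> N}"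
      using that F by (auto simp: compose_def)
    then show ?thesis
      unfolding over_ufam using that F M up.carrier_set compose_PiE[OF that F(3)] by auto
  qed
  have F\<phi>: "over \<Phi> total_proj (F \<phi>) (M, f, A i) (?X i)"
    using iff[of "restrict (\<lambda>x. x) M" M i f] ufam.over_ide[of "F \<phi>"] FGD(1)[OF \<phi>(1)] F
    by (auto simp: compose_id_right)
  have "over E P \<phi> (M, f, A i) (G (?X i))"
  proof (rule over_vertical_left[OF FGD(3)[OF \<phi>(1)] GFD(5)[OF F\<phi>]])
    show "onobj P \<phi> = onobj P (G (F \<phi>))" using FGD GFD \<phi> by simp
  qed
  then have 1: "over E P \<phi> (M, restrict (\<lambda>x. x) M, M) ?\<psi>"
    using r(4)[of \<phi> "restrict (\<lambda>x. x) M"] \<phi> F by (simp add: compose_id_right)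
  \<comment> \<open>For the converse inequality the passage is from \<open>F ?\<psi>\<close> through
    \<open>F (G (?X i))\<close> to \<open>?X i\<close> over \<open>f\<close>. By \<open>iff\<close>
    this becomes a vertical arrow to \<open>F \<phi>\<close>, which \<open>F\<close>
    reflects.\<close>
  obtain j g where F\<psi>: "F ?\<psi> = (M, j, g)" using F_cases[OF r(3)] r(2) by metis
  have "over \<Phi> total_proj (F ?\<psi>) (M, f, A i) (?X i)"
  proof (rule ufam.over_vertical_right[OF FGD(5)[OF r(1)] GFD(4)[OF X[OF F(2)]]])
    show "onobj total_proj (?X i) = onobj total_proj (F (G (?X i)))" using FGD GFD G by simp
  qed
  then have "over \<Phi> total_proj (F ?\<psi>) (M, restrict (\<lambda>x. x) M, M) (F \<phi>)"
    using iff[of "restrict (\<lambda>x. x) M" M j g] F\<psi> F by (auto simp: compose_id_right)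
  then have 2: "over E P ?\<psi> (M, restrict (\<lambda>x. x) M, M) \<phi>"
    by (rule over_F_imp[OF r(3) \<phi>(1)])
  show "\<exists>i \<in> I. \<exists>f \<in> M \<rightarrow>\<^sub>E A i. fiber_equiv (SET U) E P M \<phi> (rdx M f (A i) (G (?X i)))"
    using 1 2 F r(2) \<phi>(2) by (intro bexI[of _ i] bexI[of _ f]) (auto simp: fiber_equiv_def fiber_le_iff)
qed

lemma prestack_ufam: "prestack U E P"
  unfolding prestack_iff
proof (intro allI impI)
  note FGD = half_equivalenceD[OF FG] and GFD = half_equivalenceD[OF GF]
  fix J N e X Y
  assume J: "J \<in> U" and e: "e \<in> J \<rightarrow>\<^sub>E N" "e ` J = N" and X: "X \<in> obj E" "onobj P X = N"
    and Y: "Y \<in> obj E" "onobj P Y = N" and o: "over E P (rdx J e N X) (J, e, N) Y"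
  obtain i f where FX: "F X = (N, i, f)" "i \<in> I" "f \<in> N \<rightarrow>\<^sub>E A i"
    using F_cases[OF X(1)] X(2) by metis
  obtain j g where FY: "F Y = (N, j, g)" "j \<in> I" "g \<in> N \<rightarrow>\<^sub>E A j"
    using F_cases[OF Y(1)] Y(2) by metis
  \<comment> \<open>\<open>?Z\<close> is the reindexing of \<open>F X\<close> along \<open>e\<close>
    computed in \<open>ufam\<close>. Through \<open>G ?Z\<close>, which maps vertically into
    \<open>rdx J e N X\<close>, the assumption on \<open>E\<close> becomes a statement about image
    relations.\<close>
  let ?Z = "(J, i, compose J f e)"
  have Z: "?Z \<in> obj \<Phi>" using J FX compose_PiE[OF e(1) FX(3)] by simp
  note GZ = GFD(1,2)[OF Z]
  have N: "N \<in> U" using onobj_obj X by auto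
  have "{(compose J f e m, f (e m)) |m. m \<in> J} \<in> R i i"
    using e FX by (intro up.rel_down[OF _ _ up.rel_id]) (auto simp: compose_def)
  then have "over \<Phi> total_proj ?Z (J, e, N) (F X)"
    using FX J N e compose_PiE[OF e(1) FX(3)] by (auto simp: over_ufam)
  from over_vertical_right[OF GFD(5)[OF this] FGD(4)[OF X(1)]]
  have "over E P (G ?Z) (J, e, N) X" using FGD(1,2) GFD(2) X by simp
  then have "over E P (G ?Z) (J, restrict (\<lambda>x. x) J, J) (rdx J e N X)"
    using rdx(4)[of X J e "G ?Z" "restrict (\<lambda>x. x) J"] X J e GZ by (simp add: compose_id_right)
  then have "over E P (G ?Z) (J, e, N) Y"
    using over_vertical_left[of "G ?Z" J "rdx J e N X" "(J, e, N)" Y] o rdx(2)[of X J e] X J e by simp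
  from ufam.over_vertical_left[OF GFD(3)[OF Z] FGD(5)[OF this]]
  have "over \<Phi> total_proj ?Z (J, e, N) (F Y)" using FGD(2) GFD(1,2) Z by simp
  \<comment> \<open>Surjectivity of \<open>e\<close> enters here: every \<open>n\<close> in
    \<open>N\<close> is some \<open>e m\<close>.\<close>
  moreover have "{(compose J f e m, g (e m)) |m. m \<in> J} = {(f n, g (restrict (\<lambda>x. x) N n)) |n. n \<in> N}"
    using e(2) by (auto simp: compose_def)
  ultimately have "over \<Phi> total_proj (F X) (N, restrict (\<lambda>x. x) N, N) (F Y)"
    using FX FY N by (auto simp: over_ufam)
  then show "over E P X (N, restrict (\<lambda>x. x) N, N) Y"
    by (rule over_F_imp[OF X(1) Y(1)])
qed

end


section \<open>From a generic family to an equivalence\<close>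

context
  fixes I A \<iota>
  assumes gen: "generic_family U E P I A \<iota>"
    and pre: "prestack U E P"
begin

section \<open>The relations attached to a generic family\<close>

text \<open>By genericity every predicate on \<open>M\<close> is vertically isomorphic to one of
  this form.\<close>

definition pull where "pull M i f = rdx M f (A i) (\<iota> i)"

text \<open>The \<open>over\<close> condition expresses that \<open>pull M i f\<close> is below
  \<open>pull M j g\<close>. All spans through \<open>r\<close> are quantified over because
  \<open>r\<close> is a set of pairs and has no predicates of its own in the universe. In this form
  closure under subsets is immediate.\<close>

definition generic_rel where
  "generic_rel i j = {r. r \<subseteq> A i \<times> A j \<and>
    (\<forall>M f g. M \<in> U \<longrightarrow> f \<in> M \<rightarrow>\<^sub>E A i \<longrightarrow> g \<in> M \<rightarrow>\<^sub>E A j \<longrightarrow> (\<forall>m \<in> M. (f m, g m) \<in> r) \<longrightarrow>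
      over E P (pull M i f) (M, g, A j) (\<iota> j))}"

lemma gen_obj:
  assumes "i \<in> I"
  shows "A i \<in> U" "\<iota> i \<in> obj E" "onobj P (\<iota> i) = A i"
  using gen assms by (auto simp: generic_family_def fiber_def)

lemma pull:
  assumes "i \<in> I" "M \<in> U" "f \<in> M \<rightarrow>\<^sub>E A i"
  shows "over E P (pull M i f) (M, f, A i) (\<iota> i)"
    and "onobj P (pull M i f) = M"
    and "pull M i f \<in> obj E"
    and "over E P Y (onobj P Y, w, M) (pull M i f) \<longleftrightarrow>
      Y \<in> obj E \<and> w \<in> onobj P Y \<rightarrow>\<^sub>E M \<and>
      over E P Y (onobj P Y, compose (onobj P Y) f w, A i) (\<iota> i)"
  using rdx[of "\<iota> i" M f] gen_obj[OF assms(1)] assms(2,3) by (auto simp: pull_def)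

lemma over_pull_pull_iff:
  assumes "i \<in> I" "M \<in> U" "f \<in> M \<rightarrow>\<^sub>E A i" "j \<in> I" "N \<in> U" "g \<in> N \<rightarrow>\<^sub>E A j" "w \<in> M \<rightarrow>\<^sub>E N"
  shows "over E P (pull M i f) (M, w, N) (pull N j g) \<longleftrightarrow>
    over E P (pull M i f) (M, compose M g w, A j) (\<iota> j)"
  using pull(4)[OF assms(4-6), of "pull M i f" w] pull(2,3)[OF assms(1-3)] assms(7) by auto

lemma over_pull_compose:
  assumes "i \<in> I" "M \<in> U" "N \<in> U" "f \<in> N \<rightarrow>\<^sub>E A i" "w \<in> M \<rightarrow>\<^sub>E N"
  shows "over E P (pull M i (compose M f w)) (M, w, N) (pull N i f)"
  using assms compose_PiE[OF assms(5,4)] by (simp add: over_pull_pull_iff pull)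

text \<open>One span decides for all. The inequality for \<open>(f, g)\<close> descends along the
  surjection of \<open>M\<close> onto a copy \<open>K\<close> of the image, giving it for the
  projections \<open>p\<close> and \<open>q\<close>. Every span through the image arises from
  \<open>(p, q)\<close> by precomposition and so inherits the inequality.\<close>

lemma image_mem_generic_rel:
  assumes i: "i \<in> I" and j: "j \<in> I" and M: "M \<in> U" and f: "f \<in> M \<rightarrow>\<^sub>E A i" and g: "g \<in> M \<rightarrow>\<^sub>E A j"
    and o: "over E P (pull M i f) (M, g, A j) (\<iota> j)"
  shows "{(f m, g m) | m. m \<in> M} \<in> generic_rel i j"
proof -
  interpret set_universe U by (rule universe)
  let ?r = "{(f m, g m) | m. m \<in> M}"
  have r: "?r \<subseteq> A i \<times> A j" using f g by auto
  \<comment> \<open>\<open>K\<close> is a copy of the image relation inside the universe, with projections \<open>p\<close> and \<open>q\<close>.\<close>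
  obtain c where c: "inj_on c (A i \<times> A j)" "c ` (A i \<times> A j) \<in> U"
    using product_closed gen_obj i j by meson
  define K where "K = c ` ?r"
  have K: "K \<in> U" unfolding K_def using subset_closed[OF c(2)] r by blast
  define p where "p = restrict (\<lambda>k. fst (inv_into (A i \<times> A j) c k)) K"
  define q where "q = restrict (\<lambda>k. snd (inv_into (A i \<times> A j) c k)) K"
  have pq: "p (c x) = fst x" "q (c x) = snd x" if "x \<in> ?r" for x
  proof -
    have "x \<in> A i \<times> A j" using that r by blast
    then show "p (c x) = fst x" "q (c x) = snd x"
      using that inv_into_f_f[OF c(1)] unfolding p_def q_def K_def by auto
  qed
  have p: "p \<in> K \<rightarrow>\<^sub>E A i" and q: "q \<in> K \<rightarrow>\<^sub>E A j"
  proof -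
    have "p k \<in> A i \<and> q k \<in> A j" if "k \<in> K" for k
      using that r pq unfolding K_def by fastforce
    then show "p \<in> K \<rightarrow>\<^sub>E A i" "q \<in> K \<rightarrow>\<^sub>E A j" by (auto simp: p_def q_def)
  qed
  \<comment> \<open>The value of \<open>w\<close> is recorded in the last conjunct so that
    surjectivity of \<open>e\<close>, obtained below as an instance, can be read off.\<close>
  have fact: "\<exists>w \<in> N \<rightarrow>\<^sub>E K. f' = compose N p w \<and> g' = compose N q w \<and> (\<forall>n \<in> N. w n = c (f' n, g' n))"
    if "f' \<in> N \<rightarrow>\<^sub>E A i" "g' \<in> N \<rightarrow>\<^sub>E A j" "\<forall>n \<in> N. (f' n, g' n) \<in> ?r" for N f' g'
  proof (intro bexI conjI)
    let ?w = "restrict (\<lambda>n. c (f' n, g' n)) N"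
    show "f' = compose N p ?w" "g' = compose N q ?w"
      using that pq by (auto simp: compose_def fun_eq_iff PiE_iff extensional_def)
    show "?w \<in> N \<rightarrow>\<^sub>E K" using that by (auto simp: K_def)
  qed auto
  have "\<forall>m \<in> M. (f m, g m) \<in> ?r" by blast
  from fact[OF f g this] obtain e where e: "e \<in> M \<rightarrow>\<^sub>E K" "f = compose M p e" "g = compose M q e"
    "\<forall>m \<in> M. e m = c (f m, g m)" by blast
  have surj: "e ` M = K" using e(4) unfolding K_def by (auto simp: image_iff)
  note pp = pull[OF i K p] and pq' = pull[OF j K q]
  let ?X = "rdx M e K (pull K i p)"
  have X: "over E P ?X (M, e, K) (pull K i p)" "onobj P ?X = M" "?X \<in> obj E"
    using rdx[of "pull K i p" M e] pp M e(1) by auto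
  \<comment> \<open>Both \<open>?X\<close> and \<open>pull M i f\<close> reindex
    \<open>\<iota> i\<close> along the same map, as \<open>f\<close> is \<open>p\<close> after
    \<open>e\<close>; this comparison transfers \<open>o\<close> to \<open>?X\<close>.\<close>
  have "over E P ?X (M, restrict (\<lambda>x. x) M, M) (pull M i f)"
    using pull(4)[OF i M f, of ?X "restrict (\<lambda>x. x) M"] X f over_comp[OF X(1) pp(1)] e(2)
    by (simp add: compose_id_right)
  then have "over E P ?X (M, g, A j) (\<iota> j)"
    using over_vertical_left[of ?X M "pull M i f"] o pull(2)[OF i M f] by simp
  then have "over E P ?X (M, e, K) (pull K j q)"
    using pq'(4)[of ?X e] X e by simp
  \<comment> \<open>Descent along the surjection \<open>e\<close>: an inequality that holds after
    reindexing to \<open>M\<close> already holds on \<open>K\<close>.\<close>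
  then have "over E P (pull K i p) (K, restrict (\<lambda>x. x) K, K) (pull K j q)"
    by (rule prestack_iff[THEN iffD1, rule_format,
          OF pre M e(1) surj pp(3) pp(2) pq'(3) pq'(2)])
  then have pqo: "over E P (pull K i p) (K, q, A j) (\<iota> j)"
    using over_pull_pull_iff[OF i K p j K q] q by (simp add: compose_id_right)
  show ?thesis
    unfolding generic_rel_def
  proof (intro CollectI conjI allI impI)
    show "?r \<subseteq> A i \<times> A j" by (rule r)
    fix N f' g'
    assume N: "N \<in> U" and f': "f' \<in> N \<rightarrow>\<^sub>E A i" and g': "g' \<in> N \<rightarrow>\<^sub>E A j"
      and "\<forall>n \<in> N. (f' n, g' n) \<in> ?r"
    from fact[OF f' g' this(4)] obtain w
      where w: "w \<in> N \<rightarrow>\<^sub>E K" "f' = compose N p w" "g' = compose N q w" by blast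
    show "over E P (pull N i f') (N, g', A j) (\<iota> j)"
      using over_comp[OF over_pull_compose[OF i N K p w(1)] pqo] w by simp
  qed
qed

text \<open>From left to right the defining condition is instantiated at \<open>(f, g)\<close>; the
  converse is descent. This identifies the order of \<open>ufam\<close> with that of
  \<open>E\<close>.\<close>

lemma image_mem_generic_rel_iff:
  assumes "i \<in> I" "j \<in> I" "M \<in> U" "f \<in> M \<rightarrow>\<^sub>E A i" "g \<in> M \<rightarrow>\<^sub>E A j"
  shows "{(f m, g m) | m. m \<in> M} \<in> generic_rel i j \<longleftrightarrow> over E P (pull M i f) (M, g, A j) (\<iota> j)"
  using image_mem_generic_rel[OF assms] assms unfolding generic_rel_def by blast

lemma uniform_preorder_generic_rel: "uniform_preorder U I A generic_rel"
proof
  show "I \<in> U" using gen by (simp add: generic_family_def)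
  fix i assume i: "i \<in> I"
  show "A i \<in> U" using gen_obj i by auto
  show "Id_on (A i) \<in> generic_rel i i"
    unfolding generic_rel_def
  proof (intro CollectI conjI allI impI)
    fix M f g assume M: "M \<in> U" "f \<in> M \<rightarrow>\<^sub>E A i" "g \<in> M \<rightarrow>\<^sub>E A i" "\<forall>m \<in> M. (f m, g m) \<in> Id_on (A i)"
    then have "f = g" by (intro PiE_ext[of f M _ g]) (auto simp: Id_on_def)
    then show "over E P (pull M i f) (M, g, A i) (\<iota> i)" using pull i M by auto
  qed auto
  fix j assume j: "j \<in> I"
  show "generic_rel i j \<subseteq> Pow (A i \<times> A j)" by (auto simp: generic_rel_def)
  show "s \<in> generic_rel i j" if "r \<in> generic_rel i j" "s \<subseteq> r" for r s
    using that unfolding generic_rel_def by blast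
  fix k r s assume k: "k \<in> I" and r: "r \<in> generic_rel i j" and s: "s \<in> generic_rel j k"
  show "r O s \<in> generic_rel i k"
    unfolding generic_rel_def
  proof (intro CollectI conjI allI impI)
    show "r O s \<subseteq> A i \<times> A k" using r s unfolding generic_rel_def by blast
    fix M f h
    assume M: "M \<in> U" and f: "f \<in> M \<rightarrow>\<^sub>E A i" and h: "h \<in> M \<rightarrow>\<^sub>E A k"
      and "\<forall>m \<in> M. (f m, h m) \<in> r O s"
    then have "\<forall>m \<in> M. \<exists>y. (f m, y) \<in> r \<and> (y, h m) \<in> s" by blast
    \<comment> \<open>A chosen middle point for each \<open>m\<close> splits the span
      \<open>(f, h)\<close> into \<open>(f, g)\<close> through \<open>r\<close> and
      \<open>(g, h)\<close> through \<open>s\<close>, whose inequalities compose.\<close>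
    then obtain g0 where g0: "\<forall>m \<in> M. (f m, g0 m) \<in> r \<and> (g0 m, h m) \<in> s" by metis
    define g where "g = restrict g0 M"
    have gr: "\<forall>m \<in> M. (f m, g m) \<in> r" and gs: "\<forall>m \<in> M. (g m, h m) \<in> s"
      using g0 by (auto simp: g_def)
    have g: "g \<in> M \<rightarrow>\<^sub>E A j"
      using gr r unfolding g_def generic_rel_def by auto
    have "over E P (pull M i f) (M, g, A j) (\<iota> j)"
      using r M f g gr unfolding generic_rel_def by blast
    then have "over E P (pull M i f) (M, restrict (\<lambda>x. x) M, M) (pull M j g)"
      using over_pull_pull_iff[OF i M f j M g] g by (simp add: compose_id_right)
    moreover have "over E P (pull M j g) (M, h, A k) (\<iota> k)"
      using s M g h gs unfolding generic_rel_def by blast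
    ultimately show "over E P (pull M i f) (M, h, A k) (\<iota> k)"
      using over_vertical_left[of "pull M i f" M "pull M j g"] pull(2)[OF j M g] by simp
  qed
qed

section \<open>Comparison of the constructed \<open>ufam\<close> with the given fibration\<close>

lemma over_generic_ufam_iff:
  assumes "(M, i, f) \<in> obj (ufam U I A generic_rel)" "(N, j, g) \<in> obj (ufam U I A generic_rel)"
  shows "over (ufam U I A generic_rel) total_proj (M, i, f) t (N, j, g) \<longleftrightarrow>
    over E P (pull M i f) t (pull N j g)"
proof -
  have o: "i \<in> I" "M \<in> U" "f \<in> M \<rightarrow>\<^sub>E A i" "j \<in> I" "N \<in> U" "g \<in> N \<rightarrow>\<^sub>E A j" using assms by auto
  have *: "{(f m, g (u m)) |m. m \<in> M} \<in> generic_rel i j \<longleftrightarrow>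
      over E P (pull M i f) (M, u, N) (pull N j g)" if u: "u \<in> M \<rightarrow>\<^sub>E N" for u
  proof -
    have "{(f m, g (u m)) |m. m \<in> M} = {(f m, compose M g u m) |m. m \<in> M}"
      by (auto simp: compose_def)
    then show ?thesis
      using image_mem_generic_rel_iff[OF o(1) o(4) o(2) o(3) compose_PiE[OF u o(6)]]
        over_pull_pull_iff[OF o u] by simp
  qed
  have "\<exists>u. t = (M, u, N) \<and> u \<in> M \<rightarrow>\<^sub>E N" if "over E P (pull M i f) t (pull N j g)"
    using over_obj(3)[OF that] pull(2) o by (auto simp: hom_SET)
  then show ?thesis unfolding over_ufam using o * by blast
qed

text \<open>\<open>G\<close> is \<open>pull\<close>, which preserves and reflects arrows over the
  base; \<open>F\<close> chooses for each predicate an index and a map presenting it. All conditions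
  on \<open>F\<close> are tested after applying \<open>G\<close>, where \<open>G (F X)\<close> is
  vertically isomorphic to \<open>X\<close>.\<close>

lemma fibered_equivalent_generic_ufam:
  "fibered_equivalent (SET U) E P (ufam U I A generic_rel) total_proj"
proof -
  let ?\<Phi> = "ufam U I A generic_rel"
  have \<Phi>: "faithful_over (SET U) ?\<Phi> total_proj"
    by (rule uniform_preorder.faithful_over_ufam[OF uniform_preorder_generic_rel
          target.category_axioms])
  have "\<exists>i f. i \<in> I \<and> f \<in> onobj P X \<rightarrow>\<^sub>E A i \<and>
      over E P X (ide (SET U) (onobj P X)) (pull (onobj P X) i f) \<and>
      over E P (pull (onobj P X) i f) (ide (SET U) (onobj P X)) X" if "X \<in> obj E" for X
  proof -
    have "onobj P X \<in> U" "X \<in> fiber E P (onobj P X)"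
      using that onobj_obj by (auto simp: fiber_def)
    then obtain i f where "i \<in> I" "f \<in> onobj P X \<rightarrow>\<^sub>E A i"
      "fiber_equiv (SET U) E P (onobj P X) X (pull (onobj P X) i f)"
      using gen unfolding generic_family_def pull_def by blast
    then show ?thesis unfolding fiber_equiv_def fiber_le_iff by blast
  qed
  then obtain i f where
    if': "\<And>X. X \<in> obj E \<Longrightarrow> i X \<in> I" "\<And>X. X \<in> obj E \<Longrightarrow> f X \<in> onobj P X \<rightarrow>\<^sub>E A (i X)"
    and to: "\<And>X. X \<in> obj E \<Longrightarrow>
      over E P X (ide (SET U) (onobj P X)) (pull (onobj P X) (i X) (f X))"
    and fro: "\<And>X. X \<in> obj E \<Longrightarrow>
      over E P (pull (onobj P X) (i X) (f X)) (ide (SET U) (onobj P X)) X"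
    by metis
  define F where "F X = (onobj P X, i X, f X)" for X
  define G where "G = (\<lambda>(M, i, f). pull M i f)"
  have F: "F X \<in> obj ?\<Phi>" "onobj total_proj (F X) = onobj P X" if "X \<in> obj E" for X
    using if' that onobj_obj by (auto simp: F_def)
  have G: "G X \<in> obj E" "onobj P (G X) = onobj total_proj X" if "X \<in> obj ?\<Phi>" for X
    using that pull(2,3) by (cases X; auto simp: G_def)+
  have iff: "over ?\<Phi> total_proj X t Y \<longleftrightarrow> over E P (G X) t (G Y)"
    if "X \<in> obj ?\<Phi>" "Y \<in> obj ?\<Phi>" for X Y t
    using that over_generic_ufam_iff by (cases X; cases Y) (auto simp: G_def)
  have to': "over E P X (ide (SET U) (onobj P X)) (G (F X))"
    and fro': "over E P (G (F X)) (ide (SET U) (onobj P X)) X" if "X \<in> obj E" for X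
    using to fro that by (auto simp: F_def G_def)
  show ?thesis
  proof (rule fibered_equivalentI[OF faithful_over_axioms \<Phi>])
    show "half_equivalence (SET U) E P ?\<Phi> total_proj F G"
      unfolding half_equivalence_def
    proof (intro conjI ballI allI impI)
      fix X assume X: "X \<in> obj E"
      show "F X \<in> obj ?\<Phi>" "onobj total_proj (F X) = onobj P X"
        "over E P X (ide (SET U) (onobj P X)) (G (F X))"
        "over E P (G (F X)) (ide (SET U) (onobj P X)) X"
        by (fact F[OF X] to'[OF X] fro'[OF X])+
    next
      fix X u Y assume o: "over E P X u Y"
      note XY = over_obj(1,2)[OF o]
      have "over E P (G (F X)) u Y"
        by (rule over_vertical_left[OF fro'[OF XY(1)] o]) simp
      then have "over E P (G (F X)) u (G (F Y))"
        by (rule over_vertical_right[OF _ to'[OF XY(2)]]) simp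
      then show "over ?\<Phi> total_proj (F X) u (F Y)" using iff F XY by simp
    qed
    show "half_equivalence (SET U) ?\<Phi> total_proj E P G F"
      unfolding half_equivalence_def
    proof (intro conjI ballI allI impI)
      fix X assume X: "X \<in> obj ?\<Phi>"
      show "G X \<in> obj E" "onobj P (G X) = onobj total_proj X" by (fact G[OF X])+
      \<comment> \<open>Reflection along \<open>G\<close> reduces the comparison of \<open>X\<close>
        with \<open>F (G X)\<close> to that of \<open>G X\<close> with \<open>G (F (G X))\<close>,
        an instance of \<open>to'\<close>.\<close>
      show "over ?\<Phi> total_proj X (ide (SET U) (onobj total_proj X)) (F (G X))"
        using iff[OF X F(1)[OF G(1)[OF X]]] to'[OF G(1)[OF X]] G(2)[OF X] by simp
      show "over ?\<Phi> total_proj (F (G X)) (ide (SET U) (onobj total_proj X)) X"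
        using iff[OF F(1)[OF G(1)[OF X]] X] fro'[OF G(1)[OF X]] G(2)[OF X] by simp
    next
      fix X u Y assume o: "over ?\<Phi> total_proj X u Y"
      then show "over E P (G X) u (G Y)"
        using iff faithful_over.over_obj(1,2)[OF \<Phi> o] by blast
    qed
  qed
qed

end

end

theorem lemma4p2p5:
  fixes U :: "'u set set"
    and E :: "('o, 'a) cat"
    and P :: "('o, 'a, 'u set, 'u set_arr) fctr"
  assumes "set_universe U"
    and "fibered_preorder U E P"
  shows "(\<exists>I A R. uniform_preorder U I A R \<and>
            fibered_equivalent (SET U) E P (ufam U I A R) total_proj)
     \<longleftrightarrow> (\<exists>I A \<iota>. generic_family U E P I A \<iota>) \<and> prestack U E P"
proof -
  interpret fibered_preorder_over_sets U E P
    using assms by (rule fibered_preorder_over_sets.intro)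
  show ?thesis
  proof (intro iffI; elim exE conjE)
    fix I A R
    assume up: "uniform_preorder U I A R"
      and eq: "fibered_equivalent (SET U) E P (ufam U I A R) total_proj"
    note \<Phi> = uniform_preorder.faithful_over_ufam[OF up target.category_axioms]
    obtain F G where FG: "half_equivalence (SET U) E P (ufam U I A R) total_proj F G"
      "half_equivalence (SET U) (ufam U I A R) total_proj E P G F"
      using fibered_equivalentE[OF faithful_over_axioms \<Phi> eq] .
    show "(\<exists>I A \<iota>. generic_family U E P I A \<iota>) \<and> prestack U E P"
      using generic_family_ufam[OF up FG] prestack_ufam[OF up FG] by blast
  next
    fix I A \<iota>
    assume "generic_family U E P I A \<iota>" "prestack U E P"
    then show "\<exists>I A R. uniform_preorder U I A R \<and>
        fibered_equivalent (SET U) E P (ufam U I A R) total_proj"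
      using uniform_preorder_generic_rel fibered_equivalent_generic_ufam by blast
  qed
qed

end
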